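(* Let $\tau(\bm x)=T(L\bm x+\bm\mu)$ for $\bm x\in\mathbb R^d$, where $T(\bm y)=(T_1(y_1),\dots,T_d(y_d))$ with each $T_i:\mathbb R\to\mathbb R$ strictly monotone, $L\in\mathbb R^{d\times d}$ is a nonsingular lower-triangular matrix and $\bm\mu\in\mathbb R^d$. Let $\varepsilon\in(0,1)$ be arbitrary (arbitrarily small). 1. If there exist constants $M_T,B_T\ge0$ such that for all $1\le m\le d$ and $1\le i\le d$ one has $|D^mT_i(y)|\le B_T\exp(M_T|y|^2)$ for all $y\in\mathbb R$, then there is a constant $B_\tau\ge0$ such that for every $\bm a\in\mathbb N_0^d$ with $1\le|\bm a|\le d$ and every $i=1,\dots,d$, $$|D^{\bm a}\tau_i(\bm x)|\le B_\tau\exp(M_\tau\|\bm x\|^2)\quad\forall\,\bm x\in\mathbb R^d,\qquad M_\tau=(1+\varepsilon)M_T\,\lambda_{\max}(L^{\mathrm T}L).$$ 2. If there are constants $C_T>0$, $C_T'\in\mathbb R$ such that $|T_i(y)|^2\le C_T|y|^2+C_T'$ for all $y\in\mathbb R$ and all $i$, then there is a constant $C_\tau'\in\mathbb R$ such that $\|\tau(\bm x)\|^2\le C_\tau\|\bm x\|^2+C_\tau'$ for all $\bm x\in\mathbb R^d$, with $C_\tau=(1+\varepsilon)C_T\,\lambda_{\max}(L^{\mathrm T}L)$. 3. If there are constants $c_T>0$, $c_T'\in\mathbb R$ such that $|T_i(y)|^2\ge c_T|y|^2+c_T'$ for all $y\in\mathbb R$ and all $i$, then there is a constant $c_\tau'\in\mathbb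 R$ such that $\|\tau(\bm x)\|^2\ge c_\tau\|\bm x\|^2+c_\tau'$ for all $\bm x\in\mathbb R^d$, with $c_\tau=(1-\varepsilon)c_T\,\lambda_{\min}(L^{\mathrm T}L)$.
   Context: $\|\cdot\|$ is the Euclidean norm; $\lambda_{\max}(\cdot)$ and $\lambda_{\min}(\cdot)$ denote the largest and smallest eigenvalues. $\tau_i$ is the $i$-th component of $\tau$. For $\bm a\in\mathbb N_0^d$, $|\bm a|=a_1+\dots+a_d$ and $D^{\bm a}$ is the corresponding partial derivative; $D^mT_i$ is the $m$-th derivative (bounds on $D^mT_i$ for $1\le m\le d$ presuppose that $T_i$ is $d$ times differentiable). The constants $B_\tau,C_\tau',c_\tau'$ may depend on $\varepsilon$. *)

theory Defs
  imports "HOL-Analysis.Analysis"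
begin

definition eigenvalues :: "real^'n^'n \<Rightarrow> real set" where
  "eigenvalues A = {l. \<exists>v. v \<noteq> 0 \<and> A *v v = l *\<^sub>R v}"

(* Meaningful for matrices with at least one real eigenvalue, such as
   the symmetric matrix transpose L ** L. *)
definition lambda_max :: "real^'n^'n \<Rightarrow> real" where
  "lambda_max A = Max (eigenvalues A)"

definition lambda_min :: "real^'n^'n \<Rightarrow> real" where
  "lambda_min A = Min (eigenvalues A)"

definition lower_triangular :: "real^'n::{finite,linorder}^'n::{finite,linorder} \<Rightarrow> bool" where
  "lower_triangular A \<longleftrightarrow> (\<forall>i j. i < j \<longrightarrow> A $ i $ j = 0)"

definition strictly_monotone :: "(real \<Rightarrow> real) \<Rightarrow> bool" where
  "strictly_monotone f \<longleftrightarrow> strict_mono f \<or> strict_antimono_on UNIV f"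

definition times_differentiable :: "nat \<Rightarrow> (real \<Rightarrow> real) \<Rightarrow> bool" where
  "times_differentiable k f \<longleftrightarrow> (\<forall>m<k. \<forall>y. (deriv ^^ m) f differentiable (at y))"

definition tau :: "('n \<Rightarrow> real \<Rightarrow> real) \<Rightarrow> real^'n^'n \<Rightarrow> real^'n \<Rightarrow> real^'n \<Rightarrow> real^'n" where
  "tau T L mu x = (\<chi> i. T i ((L *v x + mu) $ i))"

definition partial_deriv :: "'n \<Rightarrow> (real^'n \<Rightarrow> real) \<Rightarrow> real^'n \<Rightarrow> real" where
  "partial_deriv j f x = deriv (\<lambda>t. f (x + t *\<^sub>R axis j 1)) 0"

(* With a type of indices 1 < ... < d, this is
   D_1^(a 1) (D_2^(a 2) (... (D_d^(a d) f))). *)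
definition multi_deriv ::
    "('n::{finite,linorder} \<Rightarrow> nat) \<Rightarrow> (real^'n::{finite,linorder} \<Rightarrow> real) \<Rightarrow> real^'n::{finite,linorder} \<Rightarrow> real" where
  "multi_deriv a f =
     foldr (\<lambda>j. partial_deriv j ^^ a j) (sorted_list_of_set UNIV) f"

(* All iterated partial derivatives of order at most k exist everywhere, whatever the
   order of differentiation. As deriv is total, existence has to be stated separately. *)
definition times_partially_differentiable :: "nat \<Rightarrow> (real^'n \<Rightarrow> real) \<Rightarrow> bool" where
  "times_partially_differentiable k f \<longleftrightarrow>
     (\<forall>js j x. length js < k \<longrightarrow>
        (\<lambda>t. foldr partial_deriv js f (x + t *\<^sub>R axis j 1)) differentiable (at 0))"

end

theory Submission
  imports Defs
begin

text \<open>Each component of \<open>tau T L mu\<close> is a ridge function: a function of one variable composed with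
  an affine functional whose linear part is a row of \<open>L\<close>. Hence an iterated partial derivative of
  order \<open>m\<close> is an \<open>m\<close>-fold product of entries of \<open>L\<close> times the \<open>m\<close>-th derivative of \<open>T i\<close>.
  All three growth bounds then follow from
  \<open>lambda_min (transpose L ** L) * (norm x)\<^sup>2 \<le> (norm (L *v x))\<^sup>2 \<le> lambda_max (transpose L ** L) * (norm x)\<^sup>2\<close>
  and Young's inequality, which absorbs the shift \<open>mu\<close> at the price of the factor
  \<open>1 + \<epsilon>\<close> or \<open>1 - \<epsilon>\<close>.\<close>

section \<open>Extreme eigenvalues of symmetric matrices\<close>

text \<open>A zero of a nonnegative quadratic form is a minimum point. Moving from \<open>v\<close>
  along \<open>f v\<close> changes the form to first order by
  \<open>2 * t * (norm (f v))\<^sup>2\<close>, which a small negative \<open>t\<close> would make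
  negative unless \<open>f v = 0\<close>.\<close>

lemma self_adjoint_psd_kernel:
  fixes f :: "'a::real_inner \<Rightarrow> 'a"
  assumes "linear f" and sym: "\<And>x y. f x \<bullet> y = x \<bullet> f y" and psd: "\<And>x. 0 \<le> x \<bullet> f x"
    and v: "v \<bullet> f v = 0"
  shows "f v = 0"
proof -
  interpret linear f by fact
  define w where "w = f v"
  define a where "a = w \<bullet> w"
  define q where "q = w \<bullet> f w"
  \<comment> \<open>The exact minimiser of \<open>2 * t * a + t\<^sup>2 * q\<close> is
    \<open>- a / q\<close>; the added 1 keeps the denominator positive when
    \<open>q = 0\<close>.\<close>
  define t where "t = - a / (q + 1)"
  have q: "0 \<le> q" unfolding q_def by (rule psd)
  then have a: "a = - t * (q + 1)" by (simp add: t_def)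
  have "0 \<le> (v + t *\<^sub>R w) \<bullet> f (v + t *\<^sub>R w)" by (rule psd)
  also have "\<dots> = 2 * t * a + t\<^sup>2 * q"
    using v sym[of v w]
    by (simp add: add scale inner_add_left inner_add_right w_def[symmetric] a_def q_def
        power2_eq_square algebra_simps inner_commute)
  also have "\<dots> = - (t\<^sup>2 * (q + 2))"
    by (simp add: a power2_eq_square algebra_simps)
  finally have "t\<^sup>2 * (q + 2) \<le> 0" by simp
  then have "a = 0"
    using q a by (simp add: mult_le_0_iff)
  then show ?thesis by (simp add: a_def w_def)
qed

text \<open>The form attains its minimum \<open>l\<close> on the compact unit sphere, and
  homogeneity extends the bound to all vectors. So \<open>f\<close> minus \<open>l\<close> times the
  identity is positive semidefinite, and its form vanishes at the minimiser, which must therefore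
  lie in its kernel.\<close>

lemma self_adjoint_min_eigenvector:
  fixes f :: "'a::euclidean_space \<Rightarrow> 'a"
  assumes "linear f" and sym: "\<And>x y. f x \<bullet> y = x \<bullet> f y"
  obtains v l where "v \<noteq> 0" "f v = l *\<^sub>R v" "\<And>x. l * (norm x)\<^sup>2 \<le> x \<bullet> f x"
proof -
  interpret linear f by fact
  obtain b :: 'a where "b \<in> Basis" using nonempty_Basis by blast
  then have "sphere (0::'a) 1 \<noteq> {}" by (metis emptyE mem_sphere_0 norm_Basis)
  moreover have "continuous_on (sphere 0 1) (\<lambda>x. x \<bullet> f x)"
    by (intro continuous_intros linear_continuous_on linear_conv_bounded_linear[THEN iffD1] \<open>linear f\<close>)
  ultimately have "\<exists>v\<in>sphere 0 1. \<forall>y\<in>sphere 0 1. v \<bullet> f v \<le> y \<bullet> f y"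
    by (intro continuous_attains_inf compact_sphere)
  then obtain v where v: "norm v = 1"
    and min: "\<And>y. norm y = 1 \<Longrightarrow> v \<bullet> f v \<le> y \<bullet> f y"
    by auto
  define l where "l = v \<bullet> f v"
  have bound: "l * (norm x)\<^sup>2 \<le> x \<bullet> f x" for x
  proof (cases "x = 0")
    case False
    have "l \<le> (x /\<^sub>R norm x) \<bullet> f (x /\<^sub>R norm x)"
      unfolding l_def using False by (intro min) simp
    also have "\<dots> = (x \<bullet> f x) / (norm x)\<^sup>2"
      by (simp add: scale divide_simps power2_eq_square)
    finally show ?thesis using False by (simp add: field_simps)
  qed simp
  have "f v - l *\<^sub>R v = 0"
  proof (rule self_adjoint_psd_kernel[where f = "\<lambda>x. f x - l *\<^sub>R x"])
    show "linear (\<lambda>x. f x - l *\<^sub>R x)"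
      by (intro linear_compose_sub \<open>linear f\<close> linear_scale_self)
    show "(f x - l *\<^sub>R x) \<bullet> y = x \<bullet> (f y - l *\<^sub>R y)" for x y
      by (simp add: inner_diff_left inner_diff_right sym)
    show "0 \<le> x \<bullet> (f x - l *\<^sub>R x)" for x
      using bound[of x] by (simp add: inner_diff_right power2_norm_eq_inner)
    show "v \<bullet> (f v - l *\<^sub>R v) = 0"
      using v by (simp add: inner_diff_right l_def flip: power2_norm_eq_inner)
  qed
  then show thesis
    using that[of v l] v bound by force
qed

lemma symmetric_inner_matrix_vector:
  fixes A :: "real^'n^'n"
  assumes "transpose A = A"
  shows "(A *v x) \<bullet> y = x \<bullet> (A *v y)"
  by (metis assms dot_lmul_matrix transpose_matrix_vector)

text \<open>Eigenvectors of distinct eigenvalues are orthogonal, hence independent, so finite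
  dimension limits their number. \<open>Max\<close> and \<open>Min\<close> in
  \<open>lambda_max\<close> and \<open>lambda_min\<close> are informative only for finite
  sets.\<close>

lemma finite_eigenvalues_symmetric:
  fixes A :: "real^'n^'n"
  assumes sym: "transpose A = A"
  shows "finite (eigenvalues A)"
proof -
  have "\<forall>l\<in>eigenvalues A. \<exists>v. v \<noteq> 0 \<and> A *v v = l *\<^sub>R v"
    by (simp add: eigenvalues_def)
  then obtain v where v: "\<And>l. l \<in> eigenvalues A \<Longrightarrow> v l \<noteq> 0 \<and> A *v v l = l *\<^sub>R v l"
    by metis
  have orth: "v l \<bullet> v k = 0" if "l \<in> eigenvalues A" "k \<in> eigenvalues A" "l \<noteq> k" for l k
  proof -
    have "l * (v l \<bullet> v k) = k * (v l \<bullet> v k)"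
      using symmetric_inner_matrix_vector[OF sym, of "v l" "v k"] v that by simp
    then show ?thesis using that by simp
  qed
  \<comment> \<open>A vector chosen for two distinct eigenvalues would be orthogonal to itself,
    hence zero. Injectivity carries finiteness from the eigenvectors back to the
    eigenvalues.\<close>
  have inj: "inj_on v (eigenvalues A)"
    by (rule inj_onI) (metis orth v inner_eq_zero_iff)
  have "independent (v ` eigenvalues A)"
  proof (rule pairwise_orthogonal_independent)
    show "pairwise orthogonal (v ` eigenvalues A)"
      using orth by (auto simp: pairwise_def orthogonal_def)
    show "0 \<notin> v ` eigenvalues A" using v by force
  qed
  then show ?thesis
    using inj independent_imp_finite finite_image_iff by blast
qed

lemma lambda_min_le_quadratic_form:
  fixes A :: "real^'n^'n"
  assumes sym: "transpose A = A"
  shows "lambda_min A * (norm x)\<^sup>2 \<le> x \<bullet> (A *v x)"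
proof -
  obtain v l where "v \<noteq> 0" "A *v v = l *\<^sub>R v" and l: "\<And>x. l * (norm x)\<^sup>2 \<le> x \<bullet> (A *v x)"
    by (rule self_adjoint_min_eigenvector[OF matrix_vector_mul_linear
          symmetric_inner_matrix_vector[OF sym]]) (rule that)
  then have "lambda_min A \<le> l"
    unfolding lambda_min_def
    by (intro Min_le finite_eigenvalues_symmetric sym) (auto simp: eigenvalues_def)
  then have "lambda_min A * (norm x)\<^sup>2 \<le> l * (norm x)\<^sup>2"
    by (simp add: mult_right_mono)
  with l[of x] show ?thesis by simp
qed

text \<open>Minimising the form of \<open>- A\<close> maximises that of \<open>A\<close>: if
  \<open>l\<close> is the minimal eigenvalue of \<open>- A\<close>, then \<open>- l\<close> is an
  eigenvalue of \<open>A\<close> and bounds its form from above.\<close>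

lemma quadratic_form_le_lambda_max:
  fixes A :: "real^'n^'n"
  assumes sym: "transpose A = A"
  shows "x \<bullet> (A *v x) \<le> lambda_max A * (norm x)\<^sup>2"
proof -
  have "linear (\<lambda>x. - (A *v x))"
    by (intro linear_compose_neg matrix_vector_mul_linear)
  then obtain v l where "v \<noteq> 0" "- (A *v v) = l *\<^sub>R v"
    and l: "\<And>x. l * (norm x)\<^sup>2 \<le> x \<bullet> (- (A *v x))"
    by (rule self_adjoint_min_eigenvector) (simp add: symmetric_inner_matrix_vector[OF sym], rule that)
  then have "v \<noteq> 0 \<and> A *v v = (- l) *\<^sub>R v"
    by (metis minus_minus scaleR_minus_left)
  then have "- l \<le> lambda_max A"
    unfolding lambda_max_def
    by (intro Max_ge finite_eigenvalues_symmetric sym) (auto simp: eigenvalues_def)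
  then have "- l * (norm x)\<^sup>2 \<le> lambda_max A * (norm x)\<^sup>2"
    by (simp only: mult_right_mono zero_le_power2)
  with l[of x] show ?thesis by simp
qed

section \<open>The Gram matrix and the norm of \<open>L *v x\<close>\<close>

lemma transpose_gram: "transpose (transpose L ** L) = transpose L ** (L :: real^'n^'m)"
  by (simp add: matrix_transpose_mul)

lemma gram_quadratic_form:
  fixes L :: "real^'n^'m"
  shows "x \<bullet> ((transpose L ** L) *v x) = (norm (L *v x))\<^sup>2"
proof -
  have "x \<bullet> ((transpose L ** L) *v x) = ((L *v x) v* L) \<bullet> x"
    by (simp add: inner_commute flip: matrix_vector_mul_assoc)
  then show ?thesis by (simp add: dot_lmul_matrix power2_norm_eq_inner)
qed

lemma norm_matrix_vector_le_lambda_max: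
  fixes L :: "real^'n^'n"
  shows "(norm (L *v x))\<^sup>2 \<le> lambda_max (transpose L ** L) * (norm x)\<^sup>2"
  using quadratic_form_le_lambda_max[OF transpose_gram, of x L] unfolding gram_quadratic_form .

lemma norm_matrix_vector_ge_lambda_min:
  fixes L :: "real^'n^'n"
  shows "lambda_min (transpose L ** L) * (norm x)\<^sup>2 \<le> (norm (L *v x))\<^sup>2"
  using lambda_min_le_quadratic_form[OF transpose_gram, of L x] unfolding gram_quadratic_form .

section \<open>Affine shifts\<close>

text \<open>Cauchy-Schwarz, followed by \<open>2 * a * b \<le> a\<^sup>2 + b\<^sup>2\<close> with
  the first factor scaled by \<open>e\<close> and the result divided by \<open>e\<close>.\<close>

lemma two_abs_inner_le_Young:
  fixes u m :: "'a::real_inner"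
  assumes "0 < e"
  shows "2 * \<bar>u \<bullet> m\<bar> \<le> e * (norm u)\<^sup>2 + (norm m)\<^sup>2 / e"
proof -
  have "2 * (norm u * norm m) * e \<le> (e * norm u)\<^sup>2 + (norm m)\<^sup>2"
    using sum_squares_bound[of "e * norm u" "norm m"] by (simp add: algebra_simps)
  then have "2 * (norm u * norm m) \<le> e * (norm u)\<^sup>2 + (norm m)\<^sup>2 / e"
    using assms by (simp add: field_simps power2_eq_square)
  then show ?thesis
    using Cauchy_Schwarz_ineq2[of u m] by linarith
qed

lemma norm_add_sq_le_Young:
  fixes u m :: "'a::real_inner"
  assumes "0 < e"
  shows "(norm (u + m))\<^sup>2 \<le> (1 + e) * (norm u)\<^sup>2 + (1 + 1 / e) * (norm m)\<^sup>2"
  using two_abs_inner_le_Young[OF assms, of u m] dot_norm[of u m] by (simp add: algebra_simps)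

lemma norm_add_sq_ge_Young:
  fixes u m :: "'a::real_inner"
  assumes "0 < e"
  shows "(1 - e) * (norm u)\<^sup>2 + (1 - 1 / e) * (norm m)\<^sup>2 \<le> (norm (u + m))\<^sup>2"
  using two_abs_inner_le_Young[OF assms, of u m] dot_norm[of u m] by (simp add: algebra_simps)

lemma norm_affine_le_lambda_max:
  fixes L :: "real^'n^'n"
  assumes "0 < e"
  shows "(norm (L *v x + mu))\<^sup>2
    \<le> (1 + e) * lambda_max (transpose L ** L) * (norm x)\<^sup>2 + (1 + 1 / e) * (norm mu)\<^sup>2"
proof -
  have "(1 + e) * (norm (L *v x))\<^sup>2 \<le> (1 + e) * (lambda_max (transpose L ** L) * (norm x)\<^sup>2)"
    using assms by (intro mult_left_mono norm_matrix_vector_le_lambda_max) simp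
  with norm_add_sq_le_Young[OF assms, of "L *v x" mu] show ?thesis by (simp add: mult.assoc)
qed

lemma norm_affine_ge_lambda_min:
  fixes L :: "real^'n^'n"
  assumes "0 < e" "e \<le> 1"
  shows "(1 - e) * lambda_min (transpose L ** L) * (norm x)\<^sup>2 + (1 - 1 / e) * (norm mu)\<^sup>2
    \<le> (norm (L *v x + mu))\<^sup>2"
proof -
  \<comment> \<open>Here \<open>e \<le> 1\<close> makes the factor \<open>1 - e\<close> nonnegative,
    so the eigenvalue bound may be multiplied by it.\<close>
  have "(1 - e) * (lambda_min (transpose L ** L) * (norm x)\<^sup>2) \<le> (1 - e) * (norm (L *v x))\<^sup>2"
    using assms by (intro mult_left_mono norm_matrix_vector_ge_lambda_min) simp
  with norm_add_sq_ge_Young[OF assms(1), of "L *v x" mu] show ?thesis by (simp add: mult.assoc)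
qed

lemma norm_vec_sq: "(norm (x :: real^'n))\<^sup>2 = (\<Sum>i\<in>UNIV. \<bar>x $ i\<bar>\<^sup>2)"
  unfolding power2_norm_eq_inner by (simp add: inner_vec_def power2_eq_square)

section \<open>Iterated partial derivatives of ridge functions\<close>

lemma ridge_has_field_derivative:
  fixes c x :: "real^'n"
  assumes "h differentiable (at (c \<bullet> x + m))"
  shows "((\<lambda>t. C * h (c \<bullet> (x + t *\<^sub>R axis j 1) + m)) has_field_derivative
    C * (deriv h (c \<bullet> x + m) * c $ j)) (at 0)"
proof -
  have "(h has_field_derivative deriv h (c \<bullet> x + m)) (at (c \<bullet> x + m))"
    using assms DERIV_deriv_iff_real_differentiable by blast
  then have "((\<lambda>t. h (c \<bullet> x + t * c $ j + m)) has_field_derivative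
      deriv h (c \<bullet> x + m) * c $ j) (at 0)"
    by (intro DERIV_chain2[where f = h]) (auto intro!: derivative_eq_intros)
  then show ?thesis
    by (auto simp: inner_add_right inner_axis intro: DERIV_cmult)
qed

text \<open>Each derivative in direction \<open>j\<close> pulls out the factor \<open>c $ j\<close>
  and raises the order of the derivative of \<open>g\<close> by one. In the induction step the
  remaining list is strictly shorter than \<open>k\<close>, so that derivative of \<open>g\<close>
  is still differentiable.\<close>

lemma foldr_partial_deriv_ridge:
  fixes c :: "real^'n"
  assumes "times_differentiable k g" and "length js \<le> k"
  shows "foldr partial_deriv js (\<lambda>x. g (c \<bullet> x + m))
    = (\<lambda>x. (\<Prod>j\<leftarrow>js. c $ j) * (deriv ^^ length js) g (c \<bullet> x + m))"
  using assms(2)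
proof (induction js)
  case (Cons j js)
  let ?h = "(deriv ^^ length js) g"
  have "partial_deriv j (\<lambda>x. (\<Prod>j\<leftarrow>js. c $ j) * ?h (c \<bullet> x + m)) x
      = (\<Prod>j\<leftarrow>js. c $ j) * (deriv ?h (c \<bullet> x + m) * c $ j)" for x
    unfolding partial_deriv_def
    using assms(1) Cons.prems
    by (intro DERIV_imp_deriv ridge_has_field_derivative) (simp add: times_differentiable_def)
  with Cons show ?case by (simp add: mult_ac)
qed simp

lemma times_partially_differentiable_ridge:
  fixes c :: "real^'n"
  assumes "times_differentiable k g"
  shows "times_partially_differentiable k (\<lambda>x. g (c \<bullet> x + m))"
  unfolding times_partially_differentiable_def
proof (intro allI impI)
  fix js :: "'n list" and j x
  assume len: "length js < k"
  then have "(deriv ^^ length js) g differentiable (at (c \<bullet> x + m))"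
    using assms by (simp add: times_differentiable_def)
  from ridge_has_field_derivative[OF this, of "\<Prod>j\<leftarrow>js. c $ j" j]
  show "(\<lambda>t. foldr partial_deriv js (\<lambda>x. g (c \<bullet> x + m)) (x + t *\<^sub>R axis j 1))
      differentiable (at 0)"
    unfolding foldr_partial_deriv_ridge[OF assms less_imp_le[OF len]] real_differentiable_def
    by blast
qed

section \<open>Multi-indices as lists of directions\<close>

lemma foldr_funpow_replicate:
  "foldr (\<lambda>j. f j ^^ a j) xs = foldr f (concat (map (\<lambda>j. replicate (a j) j) xs))"
proof (induction xs)
  case (Cons x xs)
  have "foldr f (replicate n x) = f x ^^ n" for n
    by (induction n) auto
  with Cons show ?case by (simp add: fun_eq_iff)
qed simp

text \<open>Repeating each direction \<open>j\<close> exactly \<open>a j\<close> times turns a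
  multi-index into a list, to which the ridge formula applies.\<close>

lemma multi_deriv_eq_foldr:
  obtains js where "length js = sum a UNIV" "\<And>f. multi_deriv a f = foldr partial_deriv js f"
proof
  show "length (concat (map (\<lambda>j. replicate (a j) j) (sorted_list_of_set UNIV))) = sum a UNIV"
    by (simp add: length_concat comp_def sum_list_distinct_conv_sum_set)
  show "multi_deriv a f
      = foldr partial_deriv (concat (map (\<lambda>j. replicate (a j) j) (sorted_list_of_set UNIV))) f" for f
    by (simp add: multi_deriv_def foldr_funpow_replicate)
qed

text \<open>Since \<open>1 \<le> K\<close>, shorter products are also bounded by
  \<open>K ^ k\<close>, which gives one constant for all orders up to \<open>k\<close>.\<close>

lemma abs_prod_list_le:
  fixes f :: "'a \<Rightarrow> real"
  assumes "\<And>j. \<bar>f j\<bar> \<le> K" and "1 \<le> K" and "length js \<le> k"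
  shows "\<bar>\<Prod>j\<leftarrow>js. f j\<bar> \<le> K ^ k"
proof -
  have "\<bar>\<Prod>j\<leftarrow>js. f j\<bar> \<le> K ^ length js"
    using assms(1,2) by (induction js) (auto simp: abs_mult intro!: mult_mono)
  also have "\<dots> \<le> K ^ k" using assms by (intro power_increasing)
  finally show ?thesis .
qed

section \<open>Growth bounds for \<open>tau\<close>\<close>

lemma tau_component: "tau T L mu x $ i = T i (L $ i \<bullet> x + mu $ i)"
  by (simp add: tau_def matrix_vector_mul_component)

theorem proposition1:
  fixes T :: "'d::{finite,linorder} \<Rightarrow> real \<Rightarrow> real"
    and L :: "real^'d::{finite,linorder}^'d::{finite,linorder}"
    and mu :: "real^'d::{finite,linorder}" and \<epsilon> :: real
  assumes "\<And>i. strictly_monotone (T i)"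
    and "lower_triangular L" and "invertible L"
    and "0 < \<epsilon>" and "\<epsilon> < 1"
  shows
    "(\<forall>M_T B_T :: real.
        0 \<le> M_T \<and> 0 \<le> B_T \<and>
        (\<forall>i. times_differentiable CARD('d) (T i)) \<and>
        (\<forall>m\<in>{1..CARD('d)}. \<forall>i y. \<bar>(deriv ^^ m) (T i) y\<bar> \<le> B_T * exp (M_T * \<bar>y\<bar>\<^sup>2))
        \<longrightarrow>
        (\<forall>i. times_partially_differentiable CARD('d) (\<lambda>x. tau T L mu x $ i)) \<and>
        (\<exists>B_tau \<ge> 0. \<forall>a. 1 \<le> sum a UNIV \<and> sum a UNIV \<le> CARD('d) \<longrightarrow>
           (\<forall>i x. \<bar>multi_deriv a (\<lambda>x. tau T L mu x $ i) x\<bar>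
              \<le> B_tau * exp ((1 + \<epsilon>) * M_T * lambda_max (transpose L ** L) * (norm x)\<^sup>2))))
     \<and>
     (\<forall>C_T C_T' :: real.
        0 < C_T \<and> (\<forall>i y. \<bar>T i y\<bar>\<^sup>2 \<le> C_T * \<bar>y\<bar>\<^sup>2 + C_T')
        \<longrightarrow>
        (\<exists>C_tau' :: real. \<forall>x. (norm (tau T L mu x))\<^sup>2
           \<le> (1 + \<epsilon>) * C_T * lambda_max (transpose L ** L) * (norm x)\<^sup>2 + C_tau'))
     \<and>
     (\<forall>c_T c_T' :: real.
        0 < c_T \<and> (\<forall>i y. \<bar>T i y\<bar>\<^sup>2 \<ge> c_T * \<bar>y\<bar>\<^sup>2 + c_T')
        \<longrightarrow>
        (\<exists>c_tau' :: real. \<forall>x. (norm (tau T L mu x))\<^sup>2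
           \<ge> (1 - \<epsilon>) * c_T * lambda_min (transpose L ** L) * (norm x)\<^sup>2 + c_tau'))"
proof (intro conjI allI impI; (elim conjE)?)
  fix M_T B_T :: real and i :: 'd
  assume "\<forall>i. times_differentiable CARD('d) (T i)"
  then show "times_partially_differentiable CARD('d) (\<lambda>x. tau T L mu x $ i)"
    unfolding tau_component by (intro times_partially_differentiable_ridge) simp
next
  fix M_T B_T :: real
  assume M: "0 \<le> M_T" and B: "0 \<le> B_T" and diff: "\<forall>i. times_differentiable CARD('d) (T i)"
    and bound: "\<forall>m\<in>{1..CARD('d)}. \<forall>i y. \<bar>(deriv ^^ m) (T i) y\<bar> \<le> B_T * exp (M_T * \<bar>y\<bar>\<^sup>2)"
  let ?lmax = "lambda_max (transpose L ** L)"
  \<comment> \<open>\<open>norm L\<close> dominates every entry of \<open>L\<close>; adding 1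
    ensures \<open>1 \<le> K\<close>.\<close>
  define K where "K = 1 + norm L"
  have K: "1 \<le> K" "\<bar>L $ i $ j\<bar> \<le> K" for i j
    using component_le_norm_cart[of "L $ i" j] Finite_Cartesian_Product.norm_nth_le[of L i]
    by (auto simp: K_def)
  \<comment> \<open>The factors bound the product of entries of \<open>L\<close>, the constant in
    the bound on the derivatives of \<open>T i\<close>, and the exponential of the shift term left
    by Young's inequality.\<close>
  define B_tau where "B_tau = K ^ CARD('d) * B_T * exp (M_T * ((1 + 1 / \<epsilon>) * (norm mu)\<^sup>2))"
  have "\<bar>multi_deriv a (\<lambda>x. tau T L mu x $ i) x\<bar>
      \<le> B_tau * exp ((1 + \<epsilon>) * M_T * ?lmax * (norm x)\<^sup>2)"
    if a: "1 \<le> sum a UNIV" "sum a UNIV \<le> CARD('d)" for a i x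
  proof -
    obtain js where js: "length js = sum a UNIV"
      and multi: "\<And>f. multi_deriv a f = foldr partial_deriv js f"
      using multi_deriv_eq_foldr[of a] by blast
    define y where "y = L $ i \<bullet> x + mu $ i"
    have "y = (L *v x + mu) $ i" by (simp add: y_def matrix_vector_mul_component)
    then have "\<bar>y\<bar>\<^sup>2 \<le> (norm (L *v x + mu))\<^sup>2"
      using component_le_norm_cart[of "L *v x + mu" i] by (intro power_mono) auto
    also note norm_affine_le_lambda_max[OF \<open>0 < \<epsilon>\<close>]
    finally have "M_T * \<bar>y\<bar>\<^sup>2
        \<le> M_T * ((1 + \<epsilon>) * ?lmax * (norm x)\<^sup>2 + (1 + 1 / \<epsilon>) * (norm mu)\<^sup>2)"
      using M by (intro mult_left_mono)
    then have exp_le: "exp (M_T * \<bar>y\<bar>\<^sup>2)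
        \<le> exp (M_T * ((1 + 1 / \<epsilon>) * (norm mu)\<^sup>2)) * exp ((1 + \<epsilon>) * M_T * ?lmax * (norm x)\<^sup>2)"
      unfolding exp_add[symmetric] exp_le_cancel_iff by (simp add: algebra_simps)
    have "\<bar>multi_deriv a (\<lambda>x. tau T L mu x $ i) x\<bar>
        = \<bar>\<Prod>j\<leftarrow>js. L $ i $ j\<bar> * \<bar>(deriv ^^ length js) (T i) y\<bar>"
      unfolding multi tau_component y_def
      using foldr_partial_deriv_ridge[of "CARD('d)" "T i" js "L $ i" "mu $ i"] diff a js
      by (simp add: abs_mult)
    \<comment> \<open>The order \<open>length js\<close> is at least 1, as it must be:
      \<open>bound\<close> covers derivatives of \<open>T i\<close> but not \<open>T i\<close>
      itself.\<close>
    also have "\<dots> \<le> K ^ CARD('d) * (B_T * exp (M_T * \<bar>y\<bar>\<^sup>2))"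
      using K a js bound by (intro mult_mono abs_prod_list_le) auto
    also have "\<dots> \<le> K ^ CARD('d) * (B_T * (exp (M_T * ((1 + 1 / \<epsilon>) * (norm mu)\<^sup>2))
        * exp ((1 + \<epsilon>) * M_T * ?lmax * (norm x)\<^sup>2)))"
      using K B exp_le by (intro mult_left_mono) auto
    finally show ?thesis by (simp add: B_tau_def mult.assoc)
  qed
  moreover have "0 \<le> B_tau" using K B by (simp add: B_tau_def)
  ultimately show "\<exists>B_tau \<ge> 0. \<forall>a. 1 \<le> sum a UNIV \<and> sum a UNIV \<le> CARD('d) \<longrightarrow>
      (\<forall>i x. \<bar>multi_deriv a (\<lambda>x. tau T L mu x $ i) x\<bar>
        \<le> B_tau * exp ((1 + \<epsilon>) * M_T * ?lmax * (norm x)\<^sup>2))"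
    by blast
next
  fix C_T C_T' :: real
  assume C: "0 < C_T" and bound: "\<forall>i y. \<bar>T i y\<bar>\<^sup>2 \<le> C_T * \<bar>y\<bar>\<^sup>2 + C_T'"
  let ?lmax = "lambda_max (transpose L ** L)"
  have "(norm (tau T L mu x))\<^sup>2 \<le> (1 + \<epsilon>) * C_T * ?lmax * (norm x)\<^sup>2
      + (C_T * ((1 + 1 / \<epsilon>) * (norm mu)\<^sup>2) + real CARD('d) * C_T')" for x
  proof -
    \<comment> \<open>The hypothesis is applied in each coordinate; summing recovers the norm of
      \<open>L *v x + mu\<close> and collects \<open>C_T'\<close> once per coordinate.\<close>
    have "(norm (tau T L mu x))\<^sup>2 \<le> (\<Sum>i\<in>UNIV. C_T * \<bar>(L *v x + mu) $ i\<bar>\<^sup>2 + C_T')"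
      unfolding norm_vec_sq tau_def vec_lambda_beta using bound by (intro sum_mono) blast
    also have "\<dots> = C_T * (norm (L *v x + mu))\<^sup>2 + real CARD('d) * C_T'"
      by (simp add: norm_vec_sq sum.distrib sum_distrib_left)
    also have "\<dots> \<le> C_T * ((1 + \<epsilon>) * ?lmax * (norm x)\<^sup>2 + (1 + 1 / \<epsilon>) * (norm mu)\<^sup>2)
        + real CARD('d) * C_T'"
      using C \<open>0 < \<epsilon>\<close> by (intro add_right_mono mult_left_mono norm_affine_le_lambda_max) auto
    finally show ?thesis by (simp add: algebra_simps)
  qed
  then show "\<exists>C_tau'. \<forall>x. (norm (tau T L mu x))\<^sup>2
      \<le> (1 + \<epsilon>) * C_T * ?lmax * (norm x)\<^sup>2 + C_tau'" by blast
next
  fix c_T c_T' :: real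
  assume c: "0 < c_T" and bound: "\<forall>i y. \<bar>T i y\<bar>\<^sup>2 \<ge> c_T * \<bar>y\<bar>\<^sup>2 + c_T'"
  let ?lmin = "lambda_min (transpose L ** L)"
  \<comment> \<open>The coefficient \<open>1 - 1 / \<epsilon>\<close> is negative because
    \<open>\<epsilon> < 1\<close>: the shift by \<open>mu\<close> can only lower the additive
    constant.\<close>
  have "(norm (tau T L mu x))\<^sup>2 \<ge> (1 - \<epsilon>) * c_T * ?lmin * (norm x)\<^sup>2
      + (c_T * ((1 - 1 / \<epsilon>) * (norm mu)\<^sup>2) + real CARD('d) * c_T')" for x
  proof -
    have "c_T * ((1 - \<epsilon>) * ?lmin * (norm x)\<^sup>2 + (1 - 1 / \<epsilon>) * (norm mu)\<^sup>2)
        + real CARD('d) * c_T' \<le> c_T * (norm (L *v x + mu))\<^sup>2 + real CARD('d) * c_T'"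
      using c \<open>0 < \<epsilon>\<close> \<open>\<epsilon> < 1\<close>
      by (intro add_right_mono mult_left_mono norm_affine_ge_lambda_min) auto
    also have "\<dots> = (\<Sum>i\<in>UNIV. c_T * \<bar>(L *v x + mu) $ i\<bar>\<^sup>2 + c_T')"
      by (simp add: norm_vec_sq sum.distrib sum_distrib_left)
    also have "\<dots> \<le> (norm (tau T L mu x))\<^sup>2"
      unfolding norm_vec_sq tau_def vec_lambda_beta using bound by (intro sum_mono) blast
    finally show ?thesis by (simp add: algebra_simps)
  qed
  then show "\<exists>c_tau'. \<forall>x. (norm (tau T L mu x))\<^sup>2
      \<ge> (1 - \<epsilon>) * c_T * ?lmin * (norm x)\<^sup>2 + c_tau'" by blast
qed

end
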